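(* There exists a constant $C > 0$ such that, for all positive integers $n$, $$\operatorname{xc}(\mathrm{CUT}(n+1)) = \operatorname{xc}(\mathrm{COR}(n)) \geqslant 2^{Cn}.$$ In particular, the extension complexity of $\mathrm{CUT}(n)$ is $2^{\Omega(n)}$.
   Context: A polytope is the convex hull of a finite set of points in some $\mathbb{R}^d$. An extended formulation (EF) of a polytope $P \subseteq \mathbb{R}^d$ is a linear system $E^{=}x + F^{=}y = g^{=},\ E^{\leqslant}x + F^{\leqslant}y \leqslant g^{\leqslant}$ in variables $(x,y)\in\mathbb{R}^{d+k}$ (for some $k \geqslant 0$), with real matrices $E^{=},F^{=},E^{\leqslant},F^{\leqslant}$ and real vectors $g^{=},g^{\leqslant}$, such that $x\in P$ if and only if there exists $y\in\mathbb{R}^k$ such that $(x,y)$ satisfies the system. The size of an EF is its number of inequalities (equalities are not counted). The extension complexity $\operatorname{xc}(P)$ is the minimum size of an EF of $P$. Let $K_n=(V_n,E_n)$ be the complete graph on $n$ vertices. For $X\subseteq V_n$, the cut $\delta(X)\subseteq E_n$ is the set of edges with one endpoint in $X$ and the other in $V_n\setminus X$. For $F\subseteq E_n$, $\chi^F\in\mathbb{R}^{E_n}$ is the characteristic vector of $F$. The cut polytope is $\mathrm{CUT}(n)=\operatorname{conv}\{\chi^{\delta(X)}\in\mathbb{R}^{E_n} \mid X\subseteq V_n\}$. The correlation polytope is $\mathrm{COR}(n)=\operatorname{conv}\{bb^{\intercal}\in\mathbb{R}^{n\times n}\mid b\in\{0,1\}^n\}$, where $b$ is viewed as a column vector. "$2^{\Omega(n)}$"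 means: at least $2^{cn}$ for some constant $c>0$ and all sufficiently large $n$. *)

theory Defs
  imports "HOL-Analysis.Analysis" "HOL-Analysis.Finite_Function_Topology"
begin

text \<open>
  The dimensions below vary inside a single statement, so they cannot be types. For a finite set
  \<open>I\<close> of coordinates, the space \<open>\<real>\<^sup>I\<close> is rendered as the set of those finitely supported functions
  \<open>x :: 'i \<Rightarrow>\<^sub>0 real\<close> that vanish outside \<open>I\<close>; \<open>'i \<Rightarrow>\<^sub>0 real\<close> is a real vector space, so the
  library's convex hull applies.
\<close>

definition coord_space :: "'i set \<Rightarrow> ('i \<Rightarrow>\<^sub>0 real) set" where
  "coord_space I = {x. Poly_Mapping.keys x \<subseteq> I}"

text \<open>
  The system \<open>Eeq x + Feq y = geq\<close>, \<open>Ele x + Fle y \<le> gle\<close> has \<open>p\<close> equations and \<open>m\<close> inequalities in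
  the variables \<open>x \<in> \<real>\<^sup>I\<close> and \<open>y \<in> \<real>\<^sup>k\<close>. Rows and the coordinates of \<open>y\<close> are numbered from \<open>0\<close>;
  matrix and vector entries outside these ranges are irrelevant. The parameter \<open>I\<close> (a finite set)
  is the ambient space of \<open>P\<close>, and the condition entails \<open>P \<subseteq> \<real>\<^sup>I\<close>.
\<close>

definition extended_formulation ::
  "'i set \<Rightarrow> ('i \<Rightarrow>\<^sub>0 real) set \<Rightarrow> nat \<Rightarrow> nat \<Rightarrow> nat \<Rightarrow>
   (nat \<Rightarrow> 'i \<Rightarrow> real) \<Rightarrow> (nat \<Rightarrow> nat \<Rightarrow> real) \<Rightarrow> (nat \<Rightarrow> real) \<Rightarrow>
   (nat \<Rightarrow> 'i \<Rightarrow> real) \<Rightarrow> (nat \<Rightarrow> nat \<Rightarrow> real) \<Rightarrow> (nat \<Rightarrow> real) \<Rightarrow> bool" where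
  "extended_formulation I P k p m Eeq Feq geq Ele Fle gle \<longleftrightarrow>
     P = {x \<in> coord_space I. \<exists>y :: nat \<Rightarrow> real.
       (\<forall>r<p. (\<Sum>i\<in>I. Eeq r i * Poly_Mapping.lookup x i) + (\<Sum>j<k. Feq r j * y j) = geq r) \<and>
       (\<forall>r<m. (\<Sum>i\<in>I. Ele r i * Poly_Mapping.lookup x i) + (\<Sum>j<k. Fle r j * y j) \<le> gle r)}"

text \<open>
  \<open>Inf\<close> on \<open>nat\<close> is the minimum of a nonempty set; it is \<open>0\<close> if \<open>P\<close> has no extended formulation,
  which does not happen for polytopes.
\<close>

definition xc :: "'i set \<Rightarrow> ('i \<Rightarrow>\<^sub>0 real) set \<Rightarrow> nat" where
  "xc I P = Inf {m. \<exists>k p Eeq Feq geq Ele Fle gle.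
     extended_formulation I P k p m Eeq Feq geq Ele Fle gle}"

definition complete_verts :: "nat \<Rightarrow> nat set" where
  "complete_verts n = {1..n}"

definition complete_edges :: "nat \<Rightarrow> nat set set" where
  "complete_edges n = {{u, v} |u v. u \<in> complete_verts n \<and> v \<in> complete_verts n \<and> u \<noteq> v}"

definition cut :: "nat \<Rightarrow> nat set \<Rightarrow> nat set set" where
  "cut n X = {{u, v} |u v. u \<in> X \<and> v \<in> complete_verts n - X}"

definition char_vec :: "'e set \<Rightarrow> 'e \<Rightarrow>\<^sub>0 real" where
  "char_vec F = (\<Sum>e\<in>F. Poly_Mapping.single e 1)"

lemma lookup_char_vec:
  assumes "finite F"
  shows "Poly_Mapping.lookup (char_vec F) e = (if e \<in> F then 1 else 0)"
  using assms by (simp add: char_vec_def lookup_sum lookup_single when_def)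

definition CUT :: "nat \<Rightarrow> (nat set \<Rightarrow>\<^sub>0 real) set" where
  "CUT n = convex hull {char_vec (cut n X) |X. X \<subseteq> complete_verts n}"

definition outer_square :: "nat \<Rightarrow> (nat \<Rightarrow> real) \<Rightarrow> (nat \<times> nat) \<Rightarrow>\<^sub>0 real" where
  "outer_square n b = (\<Sum>(i, j)\<in>{1..n} \<times> {1..n}. Poly_Mapping.single (i, j) (b i * b j))"

lemma lookup_outer_square:
  "Poly_Mapping.lookup (outer_square n b) (i, j) =
     (if i \<in> {1..n} \<and> j \<in> {1..n} then b i * b j else 0)"
proof -
  have "Poly_Mapping.lookup (outer_square n b) (i, j) =
      (\<Sum>q\<in>{1..n} \<times> {1..n}. if q = (i, j) then b i * b j else 0)"
    unfolding outer_square_def lookup_sum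
    by (rule sum.cong) (auto simp: lookup_single when_def split: prod.split)
  then show ?thesis by auto
qed

definition COR :: "nat \<Rightarrow> ((nat \<times> nat) \<Rightarrow>\<^sub>0 real) set" where
  "COR n = convex hull {outer_square n b |b. \<forall>i\<in>{1..n}. b i \<in> {0, 1}}"

abbreviation xc_CUT :: "nat \<Rightarrow> nat" where
  "xc_CUT n \<equiv> xc (complete_edges n) (CUT n)"

abbreviation xc_COR :: "nat \<Rightarrow> nat" where
  "xc_COR n \<equiv> xc ({1..n} \<times> {1..n}) (COR n)"

end

theory Submission
  imports Defs
begin

text \<open>
  Linear images do not increase extension complexity, and the covariance map takes the vertices of
  \<open>COR n\<close> to those of \<open>CUT (n + 1)\<close>, with a linear map in the other direction as well.

  For the lower bound, take a formulation of \<open>COR n\<close> with \<open>m\<close> inequalities. Each \<open>a \<subseteq> {1..n}\<close> gives a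
  valid inequality whose slack at the vertex of \<open>b\<close> is \<open>(1 - \<bar>a \<inter> b\<bar>)\<^sup>2\<close>. The pairs \<open>(a, b)\<close> such that
  row \<open>r\<close> is tight on the face of \<open>a\<close> but slack at a fixed lift of \<open>b\<close> form a rectangle without pairs
  \<open>\<bar>a \<inter> b\<bar> = 1\<close>, and the \<open>m\<close> rectangles cover the \<open>3 ^ n\<close> disjoint pairs. By an argument of Kaibel and
  Weltge such a rectangle contains at most \<open>2 ^ n\<close> disjoint pairs, so \<open>m \<ge> (3/2) ^ n\<close>.
\<close>

subsection \<open>Rectangle coverings of disjointness\<close>

text \<open>Induction on the ground set, splitting \<open>A\<close> and \<open>B\<close> by
  membership of the new element \<open>x\<close>. A disjoint pair has \<open>x\<close> in at most
  one component, which leaves three classes; they are regrouped into disjoint pairs of two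
  rectangles over \<open>S\<close>, each bounded by the induction hypothesis.\<close>

lemma rectangle_disjoint_pairs_le:
  assumes "finite S" "A \<subseteq> Pow S" "B \<subseteq> Pow S"
    and "\<And>a b. a \<in> A \<Longrightarrow> b \<in> B \<Longrightarrow> card (a \<inter> b) \<noteq> 1"
  shows "card {(a, b) \<in> A \<times> B. a \<inter> b = {}} \<le> 2 ^ card S"
  using assms
proof (induction S arbitrary: A B rule: finite_induct)
  case empty
  have "{(a, b) \<in> A \<times> B. a \<inter> b = {}} \<subseteq> {({}, {})}"
    using empty.prems by auto
  then have "card {(a, b) \<in> A \<times> B. a \<inter> b = {}} \<le> card {({}::'a set, {}::'a set)}"
    by (intro card_mono) auto
  then show ?case by simp
next
  case (insert x S)
  define D where "D A B = {(a, b) \<in> A \<times> B. a \<inter> b = {}}" for A B :: "'a set set"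
  define A0 A1 B0 B1 where "A0 = {a \<in> Pow S. a \<in> A}" and "A1 = {a \<in> Pow S. insert x a \<in> A}"
    and "B0 = {b \<in> Pow S. b \<in> B}" and "B1 = {b \<in> Pow S. insert x b \<in> B}"
  note defs = A0_def A1_def B0_def B1_def
  have sub: "A0 \<subseteq> Pow S" "A1 \<subseteq> Pow S" "B0 \<subseteq> Pow S" "B1 \<subseteq> Pow S"
    by (auto simp: defs)
  have fin: "finite (D A' B')" if "A' \<subseteq> Pow S" "B' \<subseteq> Pow S" for A' B'
    using that insert.hyps(1)
    by (intro finite_subset[of "D A' B'" "Pow S \<times> Pow S"]) (auto simp: D_def)
  have "D A B \<subseteq> D A0 B0 \<union> (\<lambda>(a, b). (insert x a, b)) ` D A1 B0
      \<union> (\<lambda>(a, b). (a, insert x b)) ` D A0 B1" (is "_ \<subseteq> ?U")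
  proof
    fix p assume "p \<in> D A B"
    then obtain a b where p: "p = (a, b)" "a \<in> A" "b \<in> B" "a \<inter> b = {}"
      by (auto simp: D_def)
    have "a \<subseteq> insert x S" "b \<subseteq> insert x S"
      using p insert.prems by auto
    then have mem: "x \<notin> a \<Longrightarrow> a \<in> A0" "x \<in> a \<Longrightarrow> a - {x} \<in> A1" "x \<notin> b \<Longrightarrow> b \<in> B0" "x \<in> b \<Longrightarrow> b - {x} \<in> B1"
      using p by (auto simp: defs insert_absorb)
    consider "x \<notin> a" "x \<notin> b" | "x \<in> a" "x \<notin> b" | "x \<notin> a" "x \<in> b"
      using p by auto
    then show "p \<in> ?U"
    proof cases
      case 1
      then show ?thesis using mem p by (auto simp: D_def)
    next
      case 2
      then have "(a - {x}, b) \<in> D A1 B0" using mem p by (auto simp: D_def)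
      then have "(insert x (a - {x}), b) \<in> (\<lambda>(a, b). (insert x a, b)) ` D A1 B0"
        by (intro rev_image_eqI) auto
      then show ?thesis using 2 p by (simp add: insert_absorb)
    next
      case 3
      then have "(a, b - {x}) \<in> D A0 B1" using mem p by (auto simp: D_def)
      then have "(a, insert x (b - {x})) \<in> (\<lambda>(a, b). (a, insert x b)) ` D A0 B1"
        by (intro rev_image_eqI) auto
      then show ?thesis using 3 p by (simp add: insert_absorb)
    qed
  qed
  then have "card (D A B) \<le> card ?U"
    using fin sub by (intro card_mono) auto
  also have "\<dots> \<le> card (D A0 B0) + card ((\<lambda>(a, b). (insert x a, b)) ` D A1 B0)
      + card ((\<lambda>(a, b). (a, insert x b)) ` D A0 B1)"
    by (meson add_le_mono1 card_Un_le order_trans)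
  also have "\<dots> \<le> card (D A0 B0) + card (D A1 B0) + card (D A0 B1)"
    using fin sub by (intro add_mono card_image_le) auto
  \<comment> \<open>Pairs counted twice in the union of the two classes are split off, so that they
    can be combined with \<open>D A0 B1\<close> below.\<close>
  also have "card (D A0 B0) + card (D A1 B0) = card (D (A0 \<union> A1) B0) + card (D (A0 \<inter> A1) B0)"
  proof -
    have "D A0 B0 \<union> D A1 B0 = D (A0 \<union> A1) B0" "D A0 B0 \<inter> D A1 B0 = D (A0 \<inter> A1) B0"
      by (auto simp: D_def)
    then show ?thesis using card_Un_Int[of "D A0 B0" "D A1 B0"] fin sub by simp
  qed
  also have "card (D (A0 \<union> A1) B0) + card (D (A0 \<inter> A1) B0) + card (D A0 B1) \<le> 2 ^ card S + 2 ^ card S"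
  proof -
    have no_x: "x \<notin> a" if "a \<in> Pow S" for a using that insert.hyps(2) by auto
    have 1: "card (D (A0 \<union> A1) B0) \<le> 2 ^ card S"
      unfolding D_def
    proof (rule insert.IH)
      fix a b assume ab: "a \<in> A0 \<union> A1" "b \<in> B0"
      \<comment> \<open>Adding \<open>x\<close> to only one component leaves the intersection
        unchanged, so the hypothesis on \<open>A\<close> and \<open>B\<close> transfers.\<close>
      have "insert x a \<inter> b = a \<inter> b" using no_x[of b] ab(2) sub(3) by auto
      then show "card (a \<inter> b) \<noteq> 1"
        using insert.prems(3)[of a b] insert.prems(3)[of "insert x a" b] ab by (auto simp: defs)
    qed (use sub in auto)
    have 2: "card (D A0 (B0 \<union> B1)) \<le> 2 ^ card S"
      unfolding D_def
    proof (rule insert.IH)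
      fix a b assume ab: "a \<in> A0" "b \<in> B0 \<union> B1"
      have "a \<inter> insert x b = a \<inter> b" using no_x[of a] ab(1) sub(1) by auto
      then show "card (a \<inter> b) \<noteq> 1"
        using insert.prems(3)[of a b] insert.prems(3)[of a "insert x b"] ab by (auto simp: defs)
    qed (use sub in auto)
    text \<open>A disjoint pair from \<open>A1 \<times> B1\<close> would extend to a pair meeting exactly in \<open>x\<close>.\<close>
    have "D (A0 \<inter> A1) B0 \<inter> D A0 B1 = {}"
    proof (rule ccontr)
      assume "D (A0 \<inter> A1) B0 \<inter> D A0 B1 \<noteq> {}"
      then obtain a b where ab: "a \<in> A1" "b \<in> B1" "a \<inter> b = {}" by (auto simp: D_def)
      then have "insert x a \<inter> insert x b = {x}" by auto
      then show False using insert.prems(3)[of "insert x a" "insert x b"] ab by (auto simp: defs)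
    qed
    then have "card (D (A0 \<inter> A1) B0) + card (D A0 B1) = card (D (A0 \<inter> A1) B0 \<union> D A0 B1)"
      using sub by (intro card_Un_disjoint[symmetric] fin) auto
    also have "\<dots> \<le> card (D A0 (B0 \<union> B1))"
      using sub by (intro card_mono fin) (auto simp: D_def)
    finally show ?thesis using 1 2 by linarith
  qed
  finally show ?case using insert.hyps by (simp add: D_def)
qed

text \<open>A disjoint pair amounts to a choice, for each element, between neither set, the first
  and the second; these are the values 0, 1, 2.\<close>

lemma card_disjoint_pairs_ge:
  assumes "finite S"
  shows "3 ^ card S \<le> card {(a, b) \<in> Pow S \<times> Pow S. a \<inter> b = {}}"
proof -
  define f where "f g = ({i \<in> S. g i = (1::nat)}, {i \<in> S. g i = 2})" for g :: "'a \<Rightarrow> nat"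
  have "inj_on f (S \<rightarrow>\<^sub>E {0, 1, 2})"
  proof (rule inj_onI, rule PiE_ext)
    fix g h i assume gh: "g \<in> S \<rightarrow>\<^sub>E {0, 1, 2}" "h \<in> S \<rightarrow>\<^sub>E {0, 1, 2}" "f g = f h" "i \<in> S"
    then have "g i = 1 \<longleftrightarrow> h i = 1" "g i = 2 \<longleftrightarrow> h i = 2" by (auto simp: f_def)
    moreover have "g i \<in> {0, 1, 2}" "h i \<in> {0, 1, 2}"
      using PiE_mem[OF gh(1) gh(4)] PiE_mem[OF gh(2) gh(4)] by auto
    ultimately show "g i = h i" by auto
  qed
  then have "card (S \<rightarrow>\<^sub>E {0, 1, 2::nat}) \<le> card {(a, b) \<in> Pow S \<times> Pow S. a \<inter> b = {}}"
  proof (rule card_inj_on_le)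
    show "f ` (S \<rightarrow>\<^sub>E {0, 1, 2}) \<subseteq> {(a, b) \<in> Pow S \<times> Pow S. a \<inter> b = {}}"
      by (auto simp: f_def)
    show "finite {(a, b) \<in> Pow S \<times> Pow S. a \<inter> b = {}}"
      by (rule finite_subset[of _ "Pow S \<times> Pow S"]) (use assms in auto)
  qed
  then show ?thesis using assms by (simp add: card_PiE eval_nat_numeral)
qed

text \<open>Union bound: \<open>U r\<close> and \<open>W r\<close> describe the two sides of
  rectangle \<open>r\<close>, which contains at most \<open>2 ^ card S\<close> of the at least
  \<open>3 ^ card S\<close> disjoint pairs.\<close>

lemma rectangle_cover_disjointness:
  fixes m :: nat
  assumes "finite S"
    and "\<And>r a b. r < m \<Longrightarrow> a \<subseteq> S \<Longrightarrow> b \<subseteq> S \<Longrightarrow> U r a \<Longrightarrow> W r b \<Longrightarrow> card (a \<inter> b) \<noteq> 1"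
    and "\<And>a b. a \<subseteq> S \<Longrightarrow> b \<subseteq> S \<Longrightarrow> a \<inter> b = {} \<Longrightarrow> \<exists>r<m. U r a \<and> W r b"
  shows "3 ^ card S \<le> m * 2 ^ card S"
proof -
  define R where "R r = {(a, b) \<in> {a \<in> Pow S. U r a} \<times> {b \<in> Pow S. W r b}. a \<inter> b = {}}" for r
  have fin: "finite (R r)" for r
    using assms(1) by (intro finite_subset[of "R r" "Pow S \<times> Pow S"]) (auto simp: R_def)
  have "3 ^ card S \<le> card {(a, b) \<in> Pow S \<times> Pow S. a \<inter> b = {}}"
    by (rule card_disjoint_pairs_ge[OF assms(1)])
  also have "\<dots> \<le> card (\<Union>r<m. R r)"
  proof (rule card_mono)
    show "{(a, b) \<in> Pow S \<times> Pow S. a \<inter> b = {}} \<subseteq> (\<Union>r<m. R r)"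
    proof clarify
      fix a b assume "a \<subseteq> S" "b \<subseteq> S" "a \<inter> b = {}"
      then show "(a, b) \<in> (\<Union>r<m. R r)"
        using assms(3)[of a b] by (auto simp: R_def)
    qed
    show "finite (\<Union>r<m. R r)" by (simp add: fin)
  qed
  also have "\<dots> \<le> (\<Sum>r<m. card (R r))"
    by (rule card_UN_le) simp
  also have "\<dots> \<le> (\<Sum>r<m. 2 ^ card S)"
  proof (rule sum_mono)
    fix r assume "r \<in> {..<m}"
    then show "card (R r) \<le> 2 ^ card S"
      unfolding R_def using assms(2)[of r] assms(1)
      by (intro rectangle_disjoint_pairs_le) auto
  qed
  finally show ?thesis by simp
qed

subsection \<open>Extended formulations\<close>

text \<open>
  Stands in for Farkas' lemma: only the supports of the multipliers matter for the covering
  argument, and the rows that are tight on the face cut out by \<open>l\<close> can play their role.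
\<close>
lemma tight_row_separates:
  fixes g :: "nat \<Rightarrow> 'v::real_vector \<Rightarrow> real" and l :: "'v \<Rightarrow> real"
  assumes "affine L" and lin_g: "\<And>r. r < m \<Longrightarrow> linear (g r)" and lin_l: "linear l"
    and Q: "Q = {z \<in> L. \<forall>r<m. g r z \<le> h r}"
    and valid: "\<And>z. z \<in> Q \<Longrightarrow> l z \<le> c"
    and w: "w \<in> Q" "l w = c" and z: "z \<in> Q" "l z < c"
  shows "\<exists>r<m. (\<forall>v\<in>Q. l v = c \<longrightarrow> g r v = h r) \<and> g r z < h r"
proof (rule ccontr)
  assume contr: "\<not> ?thesis"
  define N where "N = {r. r < m \<and> (\<exists>v\<in>Q. l v = c \<and> g r v \<noteq> h r)}"
  have "finite N" by (simp add: N_def)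
  have comb: "g r (s *\<^sub>R v + t *\<^sub>R v') = s * g r v + t * g r v'" if "r < m" for r s t v v'
    using lin_g[OF that] by (simp add: linear_add linear_scale)
  have comb_l: "l (s *\<^sub>R v + t *\<^sub>R v') = s * l v + t * l v'" for s t v v'
    using lin_l by (simp add: linear_add linear_scale)
  \<comment> \<open>Averaging points of the face keeps every strict inequality already achieved.
    This yields one point of the face that is slack in all rows of \<open>N\<close>, much like a
    relative interior point.\<close>
  have "\<exists>v\<in>Q. l v = c \<and> (\<forall>r\<in>N'. g r v < h r)" if "N' \<subseteq> N" for N'
    using finite_subset[OF that \<open>finite N\<close>] that
  proof (induction N' rule: finite_induct)
    case empty
    then show ?case using w by auto
  next
    case (insert r N')
    then obtain v where v: "v \<in> Q" "l v = c" "\<forall>r\<in>N'. g r v < h r" by auto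
    obtain v' where v': "r < m" "v' \<in> Q" "l v' = c" "g r v' \<noteq> h r"
      using insert.prems by (auto simp: N_def)
    then have less: "g r v' < h r" using Q by force
    define u where "u = (1/2) *\<^sub>R v + (1/2) *\<^sub>R v'"
    have le: "g q v \<le> h q" "g q v' \<le> h q" if "q < m" for q using v v' Q that by auto
    have gu: "g q u = (g q v + g q v') / 2" if "q < m" for q
      using comb[OF that] by (simp add: u_def field_simps)
    have "u \<in> L" using v v' \<open>affine L\<close> by (auto simp: u_def Q affine_def)
    moreover have "g q u \<le> h q" if "q < m" for q using le[OF that] unfolding gu[OF that] by simp
    ultimately have "u \<in> Q" by (simp add: Q)
    moreover have "l u = c" using v v' by (simp add: u_def comb_l)
    moreover have "g q u < h q" if "q \<in> insert r N'" for q
    proof -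
      have "q < m" using that insert.prems by (auto simp: N_def)
      then show ?thesis using that v(3) less le[of q] gu[of q] by fastforce
    qed
    ultimately show ?case by blast
  qed
  then obtain v where v: "v \<in> Q" "l v = c" "\<forall>r\<in>N. g r v < h r" by blast
  \<comment> \<open>The step length respects the room left at \<open>v\<close> in each row of
    \<open>N\<close>. The summand 1 keeps the denominators positive, and the inserted 1 covers empty
    \<open>N\<close>.\<close>
  define e where "e = Min (insert 1 ((\<lambda>r. (h r - g r v) / (1 + \<bar>g r v - g r z\<bar>)) ` N))"
  have "e > 0"
    unfolding e_def using \<open>finite N\<close> v(3) by (subst Min_gr_iff) (auto intro!: divide_pos_pos)
  have e: "e * (1 + \<bar>g r v - g r z\<bar>) \<le> h r - g r v" if "r \<in> N" for r
  proof -
    have "e \<le> (h r - g r v) / (1 + \<bar>g r v - g r z\<bar>)"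
      unfolding e_def using \<open>finite N\<close> that by (intro Min_le) auto
    then show ?thesis by (simp add: pos_le_divide_eq)
  qed
  \<comment> \<open>\<open>u\<close> lies on the line from \<open>z\<close> through
    \<open>v\<close>, slightly beyond \<open>v\<close>. It stays in \<open>Q\<close>, but since
    \<open>l z < c\<close> the value of \<open>l\<close> exceeds \<open>c\<close> there.\<close>
  define u where "u = (1 + e) *\<^sub>R v + (- e) *\<^sub>R z"
  have "u \<in> L" unfolding u_def using v z \<open>affine L\<close> by (intro mem_affine) (auto simp: Q)
  moreover have "g r u \<le> h r" if "r < m" for r
  proof (cases "r \<in> N")
    case True
    have "g r u = g r v + e * (g r v - g r z)"
      unfolding u_def comb[OF that] by (simp add: algebra_simps)
    also have "e * (g r v - g r z) \<le> e * (1 + \<bar>g r v - g r z\<bar>)"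
      using \<open>e > 0\<close> by (intro mult_left_mono) auto
    finally show ?thesis using e[OF True] by linarith
  next
    case False
    then have "\<forall>v\<in>Q. l v = c \<longrightarrow> g r v = h r" using that by (auto simp: N_def)
    \<comment> \<open>By the assumed failure of the claim, a row tight on the whole face is tight at
      \<open>z\<close> too, hence constant along the line.\<close>
    moreover then have "g r z = h r" using contr that z Q by force
    ultimately have "g r v = h r" "g r z = h r" using v by auto
    then show ?thesis unfolding u_def comb[OF that] by (simp add: algebra_simps)
  qed
  ultimately have "u \<in> Q" by (simp add: Q)
  then have "(1 + e) * c - e * l z \<le> c" using valid[of u] v unfolding u_def comb_l by simp
  then have "e * (c - l z) \<le> 0" by (simp add: algebra_simps)
  then show False using \<open>e > 0\<close> z by (simp add: mult_le_0_iff)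
qed

section \<open>Coordinate spaces and systems with arbitrary finite index sets\<close>

lemma lookup_scaleR [simp]:
  fixes x :: "'i \<Rightarrow>\<^sub>0 real"
  shows "Poly_Mapping.lookup (c *\<^sub>R x) i = c * Poly_Mapping.lookup x i"
proof -
  have "finite {i. c * Poly_Mapping.lookup x i \<noteq> 0}"
    by (rule finite_subset[OF _ finite_lookup[of x]]) auto
  then show ?thesis by (simp add: scaleR_poly_mapping_def)
qed

lemma coord_space_iff: "x \<in> coord_space I \<longleftrightarrow> (\<forall>i. i \<notin> I \<longrightarrow> Poly_Mapping.lookup x i = 0)"
  by (auto simp: coord_space_def in_keys_iff)

lemma subspace_coord_space: "subspace (coord_space I)"
  by (auto simp: subspace_def coord_space_iff lookup_add)

lemma lookup_sum_single:
  assumes "finite I"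
  shows "Poly_Mapping.lookup (\<Sum>i\<in>I. Poly_Mapping.single i (f i)) j = (if j \<in> I then f j else 0)"
  using assms by (simp add: lookup_sum lookup_single when_def)

text \<open>Lets rows and auxiliary variables be indexed by any finite sets, such as option or sum
  types, instead of initial segments of the naturals.\<close>

lemma extended_formulation_indexed:
  fixes E :: "'r \<Rightarrow> 'i \<Rightarrow> real" and F :: "'r \<Rightarrow> 'k \<Rightarrow> real"
    and E' :: "'q \<Rightarrow> 'i \<Rightarrow> real" and F' :: "'q \<Rightarrow> 'k \<Rightarrow> real"
  assumes "finite K" "finite R" "finite M"
    and P: "P = {x \<in> coord_space I. \<exists>y.
      (\<forall>r\<in>R. (\<Sum>i\<in>I. E r i * Poly_Mapping.lookup x i) + (\<Sum>j\<in>K. F r j * y j) = g r) \<and>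
      (\<forall>r\<in>M. (\<Sum>i\<in>I. E' r i * Poly_Mapping.lookup x i) + (\<Sum>j\<in>K. F' r j * y j) \<le> g' r)}"
  shows "\<exists>k p Eeq Feq geq Ele Fle gle. extended_formulation I P k p (card M) Eeq Feq geq Ele Fle gle"
proof -
  obtain \<kappa> where \<kappa>: "bij_betw \<kappa> {..<card K} K"
    using ex_bij_betw_nat_finite[OF \<open>finite K\<close>] by (auto simp: lessThan_atLeast0)
  obtain \<rho> where \<rho>: "bij_betw \<rho> {..<card R} R"
    using ex_bij_betw_nat_finite[OF \<open>finite R\<close>] by (auto simp: lessThan_atLeast0)
  obtain \<mu> where \<mu>: "bij_betw \<mu> {..<card M} M"
    using ex_bij_betw_nat_finite[OF \<open>finite M\<close>] by (auto simp: lessThan_atLeast0)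
  have sums: "(\<Sum>j\<in>K. h j) = (\<Sum>j<card K. h (\<kappa> j))" for h :: "'k \<Rightarrow> real"
    by (rule sum.reindex_bij_betw[OF \<kappa>, symmetric])
  have R: "(\<forall>r\<in>R. Q r) \<longleftrightarrow> (\<forall>r<card R. Q (\<rho> r))" for Q
    using ball_simps(9)[of \<rho> "{..<card R}" Q] bij_betw_imp_surj_on[OF \<rho>] by (simp add: Ball_def)
  have M: "(\<forall>r\<in>M. Q r) \<longleftrightarrow> (\<forall>r<card M. Q (\<mu> r))" for Q
    using ball_simps(9)[of \<mu> "{..<card M}" Q] bij_betw_imp_surj_on[OF \<mu>] by (simp add: Ball_def)
  \<comment> \<open>\<open>\<Phi>\<close> abstracts the system, which sees \<open>y\<close> only
    through linear forms; renaming the variables along \<open>\<kappa>\<close> therefore preserves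
    solvability.\<close>
  have ex_y: "(\<exists>y. \<Phi> (\<lambda>G. \<Sum>j<card K. G (\<kappa> j) * y (\<kappa> j))) \<longleftrightarrow>
      (\<exists>y. \<Phi> (\<lambda>G. \<Sum>j<card K. G (\<kappa> j) * y j))" for \<Phi> :: "(('k \<Rightarrow> real) \<Rightarrow> real) \<Rightarrow> bool"
  proof
    assume "\<exists>y. \<Phi> (\<lambda>G. \<Sum>j<card K. G (\<kappa> j) * y j)"
    then obtain y where y: "\<Phi> (\<lambda>G. \<Sum>j<card K. G (\<kappa> j) * y j)" ..
    have "y (inv_into {..<card K} \<kappa> (\<kappa> j)) = y j" if "j < card K" for j
      using \<kappa> that by (simp add: bij_betw_def inv_into_f_f)
    with y have "\<Phi> (\<lambda>G. \<Sum>j<card K. G (\<kappa> j) * (y \<circ> inv_into {..<card K} \<kappa>) (\<kappa> j))"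
      by simp
    then show "\<exists>y. \<Phi> (\<lambda>G. \<Sum>j<card K. G (\<kappa> j) * y (\<kappa> j))" by blast
  next
    assume "\<exists>y. \<Phi> (\<lambda>G. \<Sum>j<card K. G (\<kappa> j) * y (\<kappa> j))"
    then obtain y where "\<Phi> (\<lambda>G. \<Sum>j<card K. G (\<kappa> j) * y (\<kappa> j))" ..
    then have "\<Phi> (\<lambda>G. \<Sum>j<card K. G (\<kappa> j) * (y \<circ> \<kappa>) j)" by simp
    then show "\<exists>y. \<Phi> (\<lambda>G. \<Sum>j<card K. G (\<kappa> j) * y j)" by blast
  qed
  have "extended_formulation I P (card K) (card R) (card M)
      (E \<circ> \<rho>) (\<lambda>r j. F (\<rho> r) (\<kappa> j)) (g \<circ> \<rho>) (E' \<circ> \<mu>) (\<lambda>r j. F' (\<mu> r) (\<kappa> j)) (g' \<circ> \<mu>)"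
    unfolding extended_formulation_def P sums R M
    using ex_y[where \<Phi> = "\<lambda>f. (\<forall>r<card R. (\<Sum>i\<in>I. E (\<rho> r) i * Poly_Mapping.lookup x i)
        + f (F (\<rho> r)) = g (\<rho> r)) \<and>
      (\<forall>r<card M. (\<Sum>i\<in>I. E' (\<mu> r) i * Poly_Mapping.lookup x i) + f (F' (\<mu> r)) \<le> g' (\<mu> r))" for x]
    by simp
  then show ?thesis by blast
qed

text \<open>The auxiliary variables are the convex multipliers of the points of \<open>V\<close>.
  Row \<open>None\<close> makes them sum to 1, row \<open>Some i\<close> equates coordinate
  \<open>i\<close>, and the inequalities are nonnegativity. Existence is what makes
  \<open>xc\<close> a genuine minimum.\<close>

lemma extended_formulation_convex_hull:
  fixes V :: "('i \<Rightarrow>\<^sub>0 real) set"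
  assumes "finite I" "finite V" "V \<subseteq> coord_space I"
  shows "\<exists>k p m Eeq Feq geq Ele Fle gle.
    extended_formulation I (convex hull V) k p m Eeq Feq geq Ele Fle gle"
proof -
  have "convex hull V = {x \<in> coord_space I. \<exists>y.
      (\<forall>r\<in>insert None (Some ` I).
        (\<Sum>i\<in>I. (case r of None \<Rightarrow> 0 | Some i' \<Rightarrow> if i = i' then 1 else 0) * Poly_Mapping.lookup x i)
        + (\<Sum>v\<in>V. (case r of None \<Rightarrow> 1 | Some i' \<Rightarrow> - Poly_Mapping.lookup v i') * y v)
        = (case r of None \<Rightarrow> 1 | Some i' \<Rightarrow> 0)) \<and>
      (\<forall>r\<in>V. (\<Sum>i\<in>I. 0 * Poly_Mapping.lookup x i) + (\<Sum>v\<in>V. (if v = r then - 1 else 0) * y v) \<le> 0)}"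
    (is "_ = {x \<in> _. \<exists>y. ?eq x y \<and> ?le x y}")
  proof -
    have eq: "?eq x y \<longleftrightarrow> sum y V = 1 \<and> x = (\<Sum>v\<in>V. y v *\<^sub>R v)" if "x \<in> coord_space I" for x y
    proof -
      have "?eq x y \<longleftrightarrow> sum y V = 1 \<and>
          (\<forall>i\<in>I. Poly_Mapping.lookup x i = (\<Sum>v\<in>V. Poly_Mapping.lookup v i * y v))"
        using \<open>finite I\<close> by (auto simp: if_distrib[of "\<lambda>c. c * _"] sum_negf cong: if_cong)
      also have "\<dots> \<longleftrightarrow> sum y V = 1 \<and> x = (\<Sum>v\<in>V. y v *\<^sub>R v)"
      proof -
        have "Poly_Mapping.lookup (\<Sum>v\<in>V. y v *\<^sub>R v) i = (\<Sum>v\<in>V. Poly_Mapping.lookup v i * y v)" for i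
          by (simp add: lookup_sum mult.commute)
        moreover have "Poly_Mapping.lookup x i = 0" "(\<Sum>v\<in>V. Poly_Mapping.lookup v i * y v) = 0"
          if "i \<notin> I" for i
          using that \<open>x \<in> coord_space I\<close> assms(3) by (auto simp: coord_space_iff intro!: sum.neutral)
        ultimately have "(\<forall>i\<in>I. Poly_Mapping.lookup x i = (\<Sum>v\<in>V. Poly_Mapping.lookup v i * y v)) \<longleftrightarrow>
            (\<forall>i. Poly_Mapping.lookup x i = Poly_Mapping.lookup (\<Sum>v\<in>V. y v *\<^sub>R v) i)"
          by metis
        then show ?thesis by (simp add: poly_mapping_eq_iff fun_eq_iff)
      qed
      finally show ?thesis .
    qed
    have le: "?le x y \<longleftrightarrow> (\<forall>v\<in>V. 0 \<le> y v)" for x y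
      using \<open>finite V\<close> by (simp add: if_distrib[of "\<lambda>c. c * _"] cong: if_cong)
    have sub: "convex hull V \<subseteq> coord_space I"
      by (simp add: assms hull_minimal subspace_coord_space subspace_imp_convex)
    have hull: "x \<in> convex hull V \<longleftrightarrow> (\<exists>y. (sum y V = 1 \<and> x = (\<Sum>v\<in>V. y v *\<^sub>R v)) \<and> (\<forall>v\<in>V. 0 \<le> y v))" for x
      unfolding convex_hull_finite[OF \<open>finite V\<close>] by auto
    show ?thesis
    proof (rule Set.set_eqI)
      fix x
      show "x \<in> convex hull V \<longleftrightarrow> x \<in> {x \<in> coord_space I. \<exists>y. ?eq x y \<and> ?le x y}"
      proof (cases "x \<in> coord_space I")
        case True
        show ?thesis unfolding hull mem_Collect_eq le using eq[OF True] True by simp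
      qed (use sub in auto)
    qed
  qed
  from extended_formulation_indexed[OF \<open>finite V\<close> _ \<open>finite V\<close> this] \<open>finite I\<close>
  show ?thesis by blast
qed

section \<open>Minimum size and linear images\<close>

lemma xc_le:
  assumes "extended_formulation I P k p m Eeq Feq geq Ele Fle gle"
  shows "xc I P \<le> m"
  unfolding xc_def by (rule cInf_lower[OF _ bdd_below_bot]) (use assms in blast)

lemma xc_attained:
  assumes "extended_formulation I P k p m Eeq Feq geq Ele Fle gle"
  shows "\<exists>k p Eeq Feq geq Ele Fle gle. extended_formulation I P k p (xc I P) Eeq Feq geq Ele Fle gle"
proof -
  have "xc I P \<in> {m. \<exists>k p Eeq Feq geq Ele Fle gle.
      extended_formulation I P k p m Eeq Feq geq Ele Fle gle}"
    unfolding xc_def using assms by (intro Inf_nat_def1) blast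
  then show ?thesis by simp
qed

text \<open>The map is given by its matrix because the entries become coefficients in the
  formulation of the image.\<close>

definition matrix_map :: "'j set \<Rightarrow> 'i set \<Rightarrow> ('j \<Rightarrow> 'i \<Rightarrow> real) \<Rightarrow> ('i \<Rightarrow>\<^sub>0 real) \<Rightarrow> ('j \<Rightarrow>\<^sub>0 real)" where
  "matrix_map J I A x = (\<Sum>j\<in>J. Poly_Mapping.single j (\<Sum>i\<in>I. A j i * Poly_Mapping.lookup x i))"

lemma lookup_matrix_map:
  assumes "finite J"
  shows "Poly_Mapping.lookup (matrix_map J I A x) j =
    (if j \<in> J then \<Sum>i\<in>I. A j i * Poly_Mapping.lookup x i else 0)"
  unfolding matrix_map_def using lookup_sum_single[OF assms] .

lemma linear_matrix_map:
  assumes "finite J"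
  shows "linear (matrix_map J I A)"
  by (rule linearI; rule poly_mapping_eqI)
    (auto simp: lookup_matrix_map[OF assms] lookup_add algebra_simps sum.distrib sum_distrib_left)

lemma ball_Plus: "(\<forall>r\<in>A <+> B. Q r) \<longleftrightarrow> (\<forall>a\<in>A. Q (Inl a)) \<and> (\<forall>b\<in>B. Q (Inr b))"
  by blast

text \<open>The old point \<open>x\<close> becomes auxiliary (\<open>Inl\<close>) next to the old
  \<open>y\<close> (\<open>Inr\<close>), and the relation between \<open>x'\<close> and
  \<open>x\<close> is added as equations. Equations do not count, so the size stays
  \<open>m\<close>.\<close>

lemma extended_formulation_image:
  assumes "finite I" "finite J"
    and ef: "extended_formulation I P k p m Eeq Feq geq Ele Fle gle"
  shows "\<exists>k p Eeq Feq geq Ele Fle gle.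
    extended_formulation J (matrix_map J I A ` P) k p m Eeq Feq geq Ele Fle gle"
proof -
  define E where "E r j = (case r of Inl j' \<Rightarrow> if j = j' then 1 else (0::real) | Inr _ \<Rightarrow> 0)"
    for r :: "'b + nat" and j
  define F where "F r q = (case r of Inl j \<Rightarrow> (case q of Inl i \<Rightarrow> - A j i | Inr _ \<Rightarrow> 0)
    | Inr r' \<Rightarrow> (case q of Inl i \<Rightarrow> Eeq r' i | Inr l \<Rightarrow> Feq r' l))" for r :: "'b + nat" and q :: "'a + nat"
  define g where "g r = (case r of Inl _ \<Rightarrow> (0::real) | Inr r' \<Rightarrow> geq r')" for r :: "'b + nat"
  define F' where "F' r q = (case q of Inl i \<Rightarrow> Ele r i | Inr l \<Rightarrow> Fle r l)" for r and q :: "'a + nat"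
  let ?R = "J <+> {..<p}" and ?K = "I <+> {..<k}"
  have "matrix_map J I A ` P = {x' \<in> coord_space J. \<exists>y.
      (\<forall>r\<in>?R. (\<Sum>i\<in>J. E r i * Poly_Mapping.lookup x' i) + (\<Sum>j\<in>?K. F r j * y j) = g r) \<and>
      (\<forall>r\<in>{..<m}. (\<Sum>i\<in>J. 0 * Poly_Mapping.lookup x' i) + (\<Sum>j\<in>?K. F' r j * y j) \<le> gle r)}"
    (is "_ = {x' \<in> _. \<exists>y. ?eq x' y \<and> ?le x' y}")
  proof -
    have eq: "?eq x' y \<longleftrightarrow> (\<forall>j\<in>J. Poly_Mapping.lookup x' j = (\<Sum>i\<in>I. A j i * y (Inl i))) \<and>
        (\<forall>r<p. (\<Sum>i\<in>I. Eeq r i * y (Inl i)) + (\<Sum>j<k. Feq r j * y (Inr j)) = geq r)" for x' y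
      unfolding ball_Plus using assms(1,2)
      by (simp add: E_def F_def g_def sum.Plus sum_negf if_distrib[of "\<lambda>c. c * _"] cong: if_cong)
        (simp add: Ball_def)
    have le: "?le x' y \<longleftrightarrow> (\<forall>r<m. (\<Sum>i\<in>I. Ele r i * y (Inl i)) + (\<Sum>j<k. Fle r j * y (Inr j)) \<le> gle r)"
      for x' y
      using assms(1,2) by (simp add: F'_def sum.Plus Ball_def)
    show ?thesis
    proof (intro Set.set_eqI iffI)
      fix x' assume "x' \<in> matrix_map J I A ` P"
      then obtain x y where x: "x' = matrix_map J I A x" "x \<in> coord_space I"
        "\<forall>r<p. (\<Sum>i\<in>I. Eeq r i * Poly_Mapping.lookup x i) + (\<Sum>j<k. Feq r j * y j) = geq r"
        "\<forall>r<m. (\<Sum>i\<in>I. Ele r i * Poly_Mapping.lookup x i) + (\<Sum>j<k. Fle r j * y j) \<le> gle r"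
        using ef unfolding extended_formulation_def by blast
      have "x' \<in> coord_space J"
        by (simp add: x coord_space_iff lookup_matrix_map[OF \<open>finite J\<close>])
      moreover have "?eq x' (case_sum (Poly_Mapping.lookup x) y)
          \<and> ?le x' (case_sum (Poly_Mapping.lookup x) y)"
        unfolding eq le using x by (simp add: lookup_matrix_map[OF \<open>finite J\<close>])
      ultimately show "x' \<in> {x' \<in> coord_space J. \<exists>y. ?eq x' y \<and> ?le x' y}" by blast
    next
      fix x' assume "x' \<in> {x' \<in> coord_space J. \<exists>y. ?eq x' y \<and> ?le x' y}"
      then obtain y where y: "x' \<in> coord_space J" "?eq x' y" "?le x' y" by blast
      define x where "x = (\<Sum>i\<in>I. Poly_Mapping.single i (y (Inl i)))"
      have lx: "Poly_Mapping.lookup x i = (if i \<in> I then y (Inl i) else 0)" for i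
        unfolding x_def by (rule lookup_sum_single[OF \<open>finite I\<close>])
      have "x \<in> coord_space I" by (simp add: coord_space_iff lx)
      then have "x \<in> P"
        using y(2,3) ef unfolding eq le extended_formulation_def
        by (auto simp: lx intro!: exI[of _ "\<lambda>j. y (Inr j)"])
      moreover have "x' = matrix_map J I A x"
        using y(1,2) unfolding eq
        by (intro poly_mapping_eqI) (auto simp: lookup_matrix_map[OF \<open>finite J\<close>] lx coord_space_iff)
      ultimately show "x' \<in> matrix_map J I A ` P" by blast
    qed
  qed
  from extended_formulation_indexed[OF _ _ _ this] assms(1,2) show ?thesis by simp
qed

text \<open>The given formulation may have any size \<open>m\<close>; it guarantees that
  \<open>xc I P\<close> is attained, and an optimal formulation is then transported.\<close>

lemma xc_image_le:
  assumes "finite I" "finite J" "extended_formulation I P k p m Eeq Feq geq Ele Fle gle"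
  shows "xc J (matrix_map J I A ` P) \<le> xc I P"
proof -
  obtain k' p' Eeq' Feq' geq' Ele' Fle' gle' where
    "extended_formulation I P k' p' (xc I P) Eeq' Feq' geq' Ele' Fle' gle'"
    using xc_attained[OF assms(3)] by blast
  from extended_formulation_image[OF assms(1,2) this, of A] show ?thesis
    by (elim exE) (rule xc_le)
qed

subsection \<open>The correlation polytope\<close>

lemma linear_le_convex_hull:
  fixes f :: "'v::real_vector \<Rightarrow> real"
  assumes "linear f" "\<And>v. v \<in> V \<Longrightarrow> f v \<le> c" "x \<in> convex hull V"
  shows "f x \<le> c"
proof -
  have "convex (f -` {..c})"
    using assms(1) by (intro convex_linear_vimage) auto
  then have "convex hull V \<subseteq> f -` {..c}"
    using assms(2) by (intro hull_minimal) auto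
  then show ?thesis using assms(3) by auto
qed

text \<open>
  For \<open>x = bb\<^sup>\<top>\<close> with \<open>b\<close> the indicator vector of a set, also called \<open>b\<close>, this is \<open>1 - (1 - \<bar>a \<inter> b\<bar>)\<^sup>2\<close>.
\<close>
definition cor_form :: "nat set \<Rightarrow> (nat \<times> nat \<Rightarrow>\<^sub>0 real) \<Rightarrow> real" where
  "cor_form a x = 2 * (\<Sum>i\<in>a. Poly_Mapping.lookup x (i, i)) - (\<Sum>i\<in>a. \<Sum>j\<in>a. Poly_Mapping.lookup x (i, j))"

lemma linear_cor_form: "linear (cor_form a)"
  by (rule linearI) (simp_all add: cor_form_def lookup_add sum.distrib sum_distrib_left algebra_simps)

lemma cor_form_outer_square:
  assumes "a \<subseteq> {1..n}"
  shows "cor_form a (outer_square n b) = 2 * (\<Sum>i\<in>a. b i * b i) - (\<Sum>i\<in>a. b i)\<^sup>2"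
proof -
  have "(\<Sum>i\<in>a. Poly_Mapping.lookup (outer_square n b) (i, i)) = (\<Sum>i\<in>a. b i * b i)"
    using assms by (intro sum.cong) (auto simp: lookup_outer_square)
  moreover have "(\<Sum>i\<in>a. \<Sum>j\<in>a. Poly_Mapping.lookup (outer_square n b) (i, j)) = (\<Sum>i\<in>a. \<Sum>j\<in>a. b i * b j)"
    using assms by (intro sum.cong) (auto simp: lookup_outer_square)
  ultimately show ?thesis by (simp add: cor_form_def power2_eq_square sum_product)
qed

text \<open>At a vertex, \<open>b i * b i = b i\<close> turns the form into 1 minus a square; a
  bound on a linear form passes to the convex hull.\<close>

lemma cor_form_le:
  assumes "a \<subseteq> {1..n}" "x \<in> COR n"
  shows "cor_form a x \<le> 1"
proof (rule linear_le_convex_hull[OF linear_cor_form])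
  fix v assume "v \<in> {outer_square n b |b. \<forall>i\<in>{1..n}. b i \<in> {0, 1}}"
  then obtain b where b: "v = outer_square n b" "\<forall>i\<in>{1..n}. b i \<in> {0, 1}" by blast
  have "(\<Sum>i\<in>a. b i * b i) = (\<Sum>i\<in>a. b i)"
    using assms(1) b(2) by (intro sum.cong) auto
  moreover have "(1 - (\<Sum>i\<in>a. b i))\<^sup>2 \<ge> 0" by simp
  ultimately show "cor_form a v \<le> 1"
    unfolding b(1) cor_form_outer_square[OF assms(1)] by (simp add: power2_diff)
qed (use assms(2) in \<open>simp add: COR_def\<close>)

text \<open>A further valid inequality, for the pairs with empty \<open>a\<close> in the covering
  argument, where \<open>cor_form a\<close> vanishes identically.\<close>

lemma diagonal_nonneg_COR:
  assumes "x \<in> COR n"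
  shows "- Poly_Mapping.lookup x (i, i) \<le> 0"
proof (rule linear_le_convex_hull[where f = "\<lambda>x. - Poly_Mapping.lookup x (i, i)"])
  show "linear (\<lambda>x :: nat \<times> nat \<Rightarrow>\<^sub>0 real. - Poly_Mapping.lookup x (i, i))"
    by (rule linearI) (simp_all add: lookup_add)
  fix v assume "v \<in> {outer_square n b |b. \<forall>i\<in>{1..n}. b i \<in> {0, 1}}"
  then show "- Poly_Mapping.lookup v (i, i) \<le> 0"
    by (auto simp: lookup_outer_square)
qed (use assms in \<open>simp add: COR_def\<close>)

definition ind_square :: "nat \<Rightarrow> nat set \<Rightarrow> nat \<times> nat \<Rightarrow>\<^sub>0 real" where
  "ind_square n b = outer_square n (\<lambda>i. of_bool (i \<in> b))"

lemma ind_square_in_COR: "ind_square n b \<in> COR n"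
  unfolding COR_def ind_square_def by (rule hull_inc) auto

lemma cor_form_ind_square:
  assumes "a \<subseteq> {1..n}"
  shows "cor_form a (ind_square n b) = 1 - (1 - real (card (a \<inter> b)))\<^sup>2"
proof -
  have "finite a" using assms by (rule finite_subset) simp
  then have "(\<Sum>i\<in>a. of_bool (i \<in> b)) = real (card (a \<inter> b))"
    by (simp add: of_bool_def sum.If_cases Int_def)
  moreover from this have "(\<Sum>i\<in>a. of_bool (i \<in> b) * of_bool (i \<in> b)) = real (card (a \<inter> b))"
    by (metis (mono_tags, lifting) of_bool_eq_0_iff of_bool_eq_1_iff mult_cancel_left1 mult_zero_left sum.cong)
  ultimately show ?thesis
    unfolding ind_square_def cor_form_outer_square[OF assms] by (simp add: power2_diff)
qed

lemma extended_formulation_COR_size: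
  assumes "n \<ge> 1"
    and ef: "extended_formulation ({1..n} \<times> {1..n}) (COR n) k p m Eeq Feq geq Ele Fle gle"
  shows "3 ^ n \<le> m * 2 ^ n"
proof -
  let ?I = "{1..n} \<times> {1..n}"
  \<comment> \<open>Auxiliary vectors are taken finitely supported, so that the lifted polyhedron
    \<open>Q\<close> lies in a real vector space, as \<open>tight_row_separates\<close>
    requires.\<close>
  define f where "f E F z = (\<Sum>i\<in>?I. E i * Poly_Mapping.lookup (fst z) i)
      + (\<Sum>j<k. F j * Poly_Mapping.lookup (snd z) j)"
    for E F and z :: "((nat \<times> nat) \<Rightarrow>\<^sub>0 real) \<times> (nat \<Rightarrow>\<^sub>0 real)"
  have lin_f: "linear (f E F)" for E F
    by (rule linearI) (simp_all add: f_def lookup_add sum.distrib sum_distrib_left algebra_simps)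
  have f_comb: "f E F (u *\<^sub>R v + w *\<^sub>R v') = u * f E F v + w * f E F v'" for E F u v w v'
    using lin_f[of E F] by (simp add: linear_add linear_scale)
  define L where "L = {z. fst z \<in> coord_space ?I \<and> (\<forall>r<p. f (Eeq r) (Feq r) z = geq r)}"
  have "affine L"
    unfolding affine_def L_def
    by (auto simp: f_comb simp flip: distrib_right
        intro!: subspace_add[OF subspace_coord_space] subspace_scale[OF subspace_coord_space])
  define Q where "Q = {z \<in> L. \<forall>r<m. f (Ele r) (Fle r) z \<le> gle r}"
  have fst_Q: "fst z \<in> COR n" if "z \<in> Q" for z
    using that ef unfolding extended_formulation_def Q_def L_def f_def
    by (auto intro!: exI[of _ "Poly_Mapping.lookup (snd z)"])
  have "\<exists>z\<in>Q. fst z = ind_square n b" for b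
  proof -
    obtain y where y: "ind_square n b \<in> coord_space ?I"
      "\<forall>r<p. (\<Sum>i\<in>?I. Eeq r i * Poly_Mapping.lookup (ind_square n b) i) + (\<Sum>j<k. Feq r j * y j) = geq r"
      "\<forall>r<m. (\<Sum>i\<in>?I. Ele r i * Poly_Mapping.lookup (ind_square n b) i) + (\<Sum>j<k. Fle r j * y j) \<le> gle r"
      using ind_square_in_COR[of n b] ef unfolding extended_formulation_def by blast
    have "(ind_square n b, \<Sum>j<k. Poly_Mapping.single j (y j)) \<in> Q"
      using y by (simp add: Q_def L_def f_def lookup_sum_single)
    then show ?thesis by force
  qed
  then obtain z where z: "\<And>b. z b \<in> Q" "\<And>b. fst (z b) = ind_square n b" by metis
  define l where "l a v = cor_form a (fst v)"
    for a and v :: "((nat \<times> nat) \<Rightarrow>\<^sub>0 real) \<times> (nat \<Rightarrow>\<^sub>0 real)"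
  have lin_l: "linear (l a)" for a
    unfolding l_def using linear_compose[OF linear_fst linear_cor_form[of a]] by (simp add: o_def)
  have l_le: "l a v \<le> 1" if "a \<subseteq> {1..n}" "v \<in> Q" for a v
    unfolding l_def using cor_form_le[OF that(1) fst_Q[OF that(2)]] .
  have l_z: "l a (z b) = 1 - (1 - real (card (a \<inter> b)))\<^sup>2" if "a \<subseteq> {1..n}" for a b
    unfolding l_def z(2) by (rule cor_form_ind_square[OF that])
  define U where "U r a \<longleftrightarrow> (\<forall>v\<in>Q. l a v = 1 \<longrightarrow> f (Ele r) (Fle r) v = gle r)" for r a
  define W where "W r b \<longleftrightarrow> f (Ele r) (Fle r) (z b) < gle r" for r b
  \<comment> \<open>For nonempty \<open>a\<close>, the lift of \<open>{i}\<close> with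
    \<open>i \<in> a\<close> lies on the face of \<open>a\<close>, while a disjoint \<open>b\<close>
    has slack 1.\<close>
  have cover: "\<exists>r<m. U r a \<and> W r b" if "i \<in> a" "a \<subseteq> {1..n}" "a \<inter> b = {}" for i a b
    unfolding U_def W_def
  proof (rule tight_row_separates[OF \<open>affine L\<close> lin_f lin_l Q_def])
    have "a \<inter> {i} = {i}" using that(1) by blast
    then show "l a (z {i}) = 1" using l_z[OF that(2)] by simp
    show "l a (z b) < 1" using l_z[OF that(2)] that(3) by simp
  qed (use z l_le that in auto)
  \<comment> \<open>For \<open>a = {}\<close> the face is empty, so \<open>U r a\<close> is vacuous
    and any row slack at \<open>z b\<close> will do. If \<open>1 \<in> b\<close>, such a row comes
    from the diagonal inequality at \<open>(1, 1)\<close>, which is tight at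
    \<open>z {}\<close>.\<close>
  have W: "\<exists>r<m. W r b" for b
  proof (cases "1 \<in> b")
    case False
    then show ?thesis using cover[of 1 "{1}" b] \<open>n \<ge> 1\<close> by auto
  next
    case True
    let ?l = "\<lambda>v :: ((nat \<times> nat) \<Rightarrow>\<^sub>0 real) \<times> (nat \<Rightarrow>\<^sub>0 real). - Poly_Mapping.lookup (fst v) (1, 1)"
    have "\<exists>r<m. (\<forall>v\<in>Q. ?l v = 0 \<longrightarrow> f (Ele r) (Fle r) v = gle r) \<and> f (Ele r) (Fle r) (z b) < gle r"
    proof (rule tight_row_separates[OF \<open>affine L\<close> lin_f _ Q_def])
      show "linear ?l" by (rule linearI) (simp_all add: lookup_add)
      show "?l v \<le> 0" if "v \<in> Q" for v using diagonal_nonneg_COR[OF fst_Q[OF that]] .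
      show "?l (z {}) = 0" by (simp add: z ind_square_def lookup_outer_square)
      show "?l (z b) < 0" using True \<open>n \<ge> 1\<close> by (simp add: z ind_square_def lookup_outer_square)
    qed (use z in auto)
    then show ?thesis by (auto simp: W_def)
  qed
  have "3 ^ card {1..n} \<le> m * 2 ^ card {1..n}"
  proof (rule rectangle_cover_disjointness)
    fix r a b assume "r < m" "a \<subseteq> {1..n}" "b \<subseteq> {1..n}" "U r a" "W r b"
    \<comment> \<open>If the intersection had one element, \<open>z b\<close> would lie on the face
      of \<open>a\<close>, where row \<open>r\<close> is tight by \<open>U\<close> but slack by
      \<open>W\<close>.\<close>
    then show "card (a \<inter> b) \<noteq> 1"
      using l_z[of a b] z(1)[of b] by (auto simp: U_def W_def)
  next
    fix a b assume "a \<subseteq> {1..n}" "b \<subseteq> {1..n}" "a \<inter> b = {}"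
    show "\<exists>r<m. U r a \<and> W r b"
    proof (cases "a = {}")
      case True
      have "U r a" for r by (simp add: True U_def l_def cor_form_def)
      then show ?thesis using W by blast
    next
      case False
      then show ?thesis using cover \<open>a \<subseteq> {1..n}\<close> \<open>a \<inter> b = {}\<close> by blast
    qed
  qed simp
  then show ?thesis by simp
qed

subsection \<open>The covariance map\<close>

lemma finite_complete_edges: "finite (complete_edges n)"
  by (rule finite_subset[of _ "Pow {1..n}"]) (auto simp: complete_edges_def complete_verts_def)

lemma cut_subset: "X \<subseteq> complete_verts n \<Longrightarrow> cut n X \<subseteq> complete_edges n"
  unfolding cut_def complete_edges_def by blast

lemma doubleton_in_cut_iff:
  assumes "u \<in> complete_verts n" "v \<in> complete_verts n"
  shows "{u, v} \<in> cut n X \<longleftrightarrow> (u \<in> X) \<noteq> (v \<in> X)"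
  using assms by (auto simp: cut_def doubleton_eq_iff)

lemma lookup_char_vec_cut:
  assumes "X \<subseteq> complete_verts n"
  shows "Poly_Mapping.lookup (char_vec (cut n X)) e = of_bool (e \<in> cut n X)"
  using finite_subset[OF cut_subset[OF assms] finite_complete_edges] by (simp add: lookup_char_vec)

text \<open>
  From \<open>\<bar>b\<^sub>u - b\<^sub>v\<bar> = b\<^sub>u\<^sup>2 + b\<^sub>v\<^sup>2 - 2 b\<^sub>u b\<^sub>v\<close> and \<open>2 b\<^sub>i b\<^sub>j = b\<^sub>i + b\<^sub>j - \<bar>b\<^sub>i - b\<^sub>j\<bar>\<close> for \<open>0/1\<close> vectors with
  \<open>b\<close> extended by \<open>0\<close> at \<open>n + 1\<close>. If \<open>i = j\<close>, the last summand of \<open>cor_of_cut\<close> is harmless, as \<open>{i, i}\<close> is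
  not an edge.
\<close>
definition cut_of_cor :: "nat set \<Rightarrow> nat \<times> nat \<Rightarrow> real" where
  "cut_of_cor e = (\<lambda>(i, j). of_bool (i = j \<and> i \<in> e) - of_bool ({i, j} = e))"

definition cor_of_cut :: "nat \<Rightarrow> nat \<times> nat \<Rightarrow> nat set \<Rightarrow> real" where
  "cor_of_cut n = (\<lambda>(i, j) e.
    (of_bool (e = {i, n + 1}) + of_bool (e = {j, n + 1}) - of_bool (e = {i, j})) / 2)"

text \<open>
  A cut is determined by \<open>X\<close> only up to complementation; this is the indicator vector of the side
  that avoids the vertex \<open>n + 1\<close>.
\<close>
definition side_vec :: "nat \<Rightarrow> nat set \<Rightarrow> nat \<Rightarrow> real" where
  "side_vec n X i = of_bool ((i \<in> X) \<noteq> (n + 1 \<in> X))"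

lemma matrix_map_cut_of_cor:
  assumes X: "X \<subseteq> complete_verts (n + 1)"
  shows "matrix_map (complete_edges (n + 1)) ({1..n} \<times> {1..n}) cut_of_cor (outer_square n (side_vec n X))
    = char_vec (cut (n + 1) X)"
proof (rule poly_mapping_eqI)
  fix e
  let ?I = "{1..n} \<times> {1..n}" and ?x = "outer_square n (side_vec n X)" and ?b = "side_vec n X"
  have "(\<Sum>q\<in>?I. cut_of_cor e q * Poly_Mapping.lookup ?x q) = of_bool (e \<in> cut (n + 1) X)"
    if edge: "e \<in> complete_edges (n + 1)"
  proof -
    obtain u v where uv: "e = {u, v}" "u \<noteq> v" "u \<in> complete_verts (n + 1)" "v \<in> complete_verts (n + 1)"
      using edge unfolding complete_edges_def by blast
    \<comment> \<open>The product formula also covers the vertex \<open>n + 1\<close>: the matrix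
      has no such entry, and \<open>side_vec\<close> vanishes there.\<close>
    have lookup: "Poly_Mapping.lookup ?x (i, j) = ?b i * ?b j" if "i \<in> {u, v}" "j \<in> {u, v}" for i j
    proof -
      have "?b i = 0" if "i \<in> {u, v}" "i \<notin> {1..n}" for i
        using that uv(3,4) by (auto simp: complete_verts_def side_vec_def not_le le_Suc_eq)
      then show ?thesis using that unfolding lookup_outer_square by auto
    qed
    \<comment> \<open>Only these four positions have nonzero coefficients. Those outside the index
      square contribute 0.\<close>
    have "(\<Sum>q\<in>?I. cut_of_cor e q * Poly_Mapping.lookup ?x q)
        = (\<Sum>q\<in>{(u, u), (v, v), (u, v), (v, u)}. cut_of_cor e q * Poly_Mapping.lookup ?x q)"
      by (rule sum.mono_neutral_cong)
        (auto simp: lookup_outer_square cut_of_cor_def uv(1) doubleton_eq_iff of_bool_def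
          split: if_splits)
    also have "\<dots> = (?b u - ?b v)\<^sup>2"
      using uv(2) by (auto simp: lookup cut_of_cor_def uv(1) power2_eq_square algebra_simps)
    also have "\<dots> = of_bool (e \<in> cut (n + 1) X)"
      unfolding uv(1) doubleton_in_cut_iff[OF uv(3,4)] by (simp add: side_vec_def)
    finally show ?thesis .
  qed
  then show "Poly_Mapping.lookup (matrix_map (complete_edges (n + 1)) ?I cut_of_cor ?x) e
      = Poly_Mapping.lookup (char_vec (cut (n + 1) X)) e"
    unfolding lookup_matrix_map[OF finite_complete_edges] lookup_char_vec_cut[OF X]
    using cut_subset[OF X] by auto
qed

lemma matrix_map_cor_of_cut:
  assumes X: "X \<subseteq> complete_verts (n + 1)"
  shows "matrix_map ({1..n} \<times> {1..n}) (complete_edges (n + 1)) (cor_of_cut n) (char_vec (cut (n + 1) X))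
    = outer_square n (side_vec n X)"
proof (rule poly_mapping_eqI, clarify)
  fix i j
  let ?I = "{1..n} \<times> {1..n}" and ?E = "complete_edges (n + 1)" and ?z = "char_vec (cut (n + 1) X)"
  \<comment> \<open>This holds for non-edges \<open>e'\<close> as well, in particular for
    \<open>{i, i}\<close>: both sides are then 0.\<close>
  have pick: "(\<Sum>e\<in>?E. of_bool (e = e') * Poly_Mapping.lookup ?z e) = of_bool (e' \<in> cut (n + 1) X)" for e'
  proof -
    have "(\<Sum>e\<in>?E. of_bool (e = e') * Poly_Mapping.lookup ?z e)
        = (\<Sum>e\<in>?E. if e = e' then Poly_Mapping.lookup ?z e else 0)"
      by (rule sum.cong) auto
    also have "\<dots> = (if e' \<in> ?E then Poly_Mapping.lookup ?z e' else 0)"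
      by (simp only: sum.delta[OF finite_complete_edges])
    also have "\<dots> = of_bool (e' \<in> cut (n + 1) X)"
      unfolding lookup_char_vec_cut[OF X] using cut_subset[OF X] by auto
    finally show ?thesis .
  qed
  have "(\<Sum>e\<in>?E. cor_of_cut n (i, j) e * Poly_Mapping.lookup ?z e) = side_vec n X i * side_vec n X j"
    if "i \<in> {1..n}" "j \<in> {1..n}"
  proof -
    have verts: "i \<in> complete_verts (n + 1)" "j \<in> complete_verts (n + 1)" "n + 1 \<in> complete_verts (n + 1)"
      using that by (auto simp: complete_verts_def)
    have "(\<Sum>e\<in>?E. cor_of_cut n (i, j) e * Poly_Mapping.lookup ?z e) =
      ((\<Sum>e\<in>?E. of_bool (e = {i, n + 1}) * Poly_Mapping.lookup ?z e)
       + (\<Sum>e\<in>?E. of_bool (e = {j, n + 1}) * Poly_Mapping.lookup ?z e)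
       - (\<Sum>e\<in>?E. of_bool (e = {i, j}) * Poly_Mapping.lookup ?z e)) / 2"
      unfolding sum.distrib[symmetric] sum_subtractf[symmetric] sum_divide_distrib
      by (intro sum.cong refl) (simp add: cor_of_cut_def field_simps)
    also have "\<dots> = side_vec n X i * side_vec n X j"
      unfolding pick using verts by (simp add: doubleton_in_cut_iff side_vec_def)
    finally show ?thesis .
  qed
  then show "Poly_Mapping.lookup (matrix_map ?I ?E (cor_of_cut n) ?z) (i, j)
      = Poly_Mapping.lookup (outer_square n (side_vec n X)) (i, j)"
    by (simp add: lookup_matrix_map lookup_outer_square)
qed

section \<open>The two polytopes as linear images of each other\<close>

text \<open>Indexing the vertices by the same sets \<open>X\<close> as in \<open>CUT (n + 1)\<close>
  lets both images be compared vertex by vertex. Complementary sets give the same vertex, and each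
  0/1 vector arises from a set avoiding \<open>n + 1\<close>.\<close>

lemma COR_eq_hull_side_vec:
  "COR n = convex hull ((\<lambda>X. outer_square n (side_vec n X)) ` Pow (complete_verts (n + 1)))"
proof -
  have "{outer_square n b |b. \<forall>i\<in>{1..n}. b i \<in> {0, 1}}
      = (\<lambda>X. outer_square n (side_vec n X)) ` Pow (complete_verts (n + 1))"
  proof (intro Set.set_eqI iffI)
    fix x assume "x \<in> {outer_square n b |b. \<forall>i\<in>{1..n}. b i \<in> {0, 1}}"
    then obtain b where b: "x = outer_square n b" "\<forall>i\<in>{1..n}. b i \<in> {0, 1}" by blast
    define X where "X = {i \<in> {1..n}. b i = 1}"
    have "side_vec n X i = b i" if "i \<in> {1..n}" for i
      using b(2) that by (auto simp: side_vec_def X_def)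
    then have "x = outer_square n (side_vec n X)"
      unfolding b(1) by (intro poly_mapping_eqI) (auto simp: lookup_outer_square)
    moreover have "X \<in> Pow (complete_verts (n + 1))" by (auto simp: X_def complete_verts_def)
    ultimately show "x \<in> (\<lambda>X. outer_square n (side_vec n X)) ` Pow (complete_verts (n + 1))" by blast
  next
    fix x assume "x \<in> (\<lambda>X. outer_square n (side_vec n X)) ` Pow (complete_verts (n + 1))"
    moreover have "side_vec n X i \<in> {0, 1}" for X i by (auto simp: side_vec_def)
    ultimately show "x \<in> {outer_square n b |b. \<forall>i\<in>{1..n}. b i \<in> {0, 1}}" by blast
  qed
  then show ?thesis by (simp add: COR_def)
qed

lemma CUT_eq_hull_image: "CUT n = convex hull ((\<lambda>X. char_vec (cut n X)) ` Pow (complete_verts n))"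
  unfolding CUT_def by (rule arg_cong[where f = "(hull) convex"]) auto

lemma CUT_eq_image_COR:
  "CUT (n + 1) = matrix_map (complete_edges (n + 1)) ({1..n} \<times> {1..n}) cut_of_cor ` COR n"
  unfolding COR_eq_hull_side_vec CUT_eq_hull_image
    convex_hull_linear_image[OF linear_matrix_map[OF finite_complete_edges]] image_image
  by (rule arg_cong[where f = "(hull) convex"], rule image_cong)
    (simp_all add: matrix_map_cut_of_cor[simplified])

lemma COR_eq_image_CUT:
  "COR n = matrix_map ({1..n} \<times> {1..n}) (complete_edges (n + 1)) (cor_of_cut n) ` CUT (n + 1)"
proof -
  have fin: "finite ({1..n} \<times> {1..n})" by simp
  show ?thesis
    unfolding COR_eq_hull_side_vec CUT_eq_hull_image
      convex_hull_linear_image[OF linear_matrix_map[OF fin]] image_image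
    by (rule arg_cong[where f = "(hull) convex"], rule image_cong)
    (simp_all add: matrix_map_cor_of_cut[simplified])
qed

lemma extended_formulation_COR_exists:
  "\<exists>k p m Eeq Feq geq Ele Fle gle.
    extended_formulation ({1..n} \<times> {1..n}) (COR n) k p m Eeq Feq geq Ele Fle gle"
  unfolding COR_eq_hull_side_vec
  by (rule extended_formulation_convex_hull)
    (auto simp: complete_verts_def coord_space_iff lookup_outer_square)

lemma xc_CUT_eq_xc_COR: "xc_CUT (n + 1) = xc_COR n"
proof (rule antisym)
  have fin: "finite ({1..n} \<times> {1..n})" by simp
  obtain k p m Eeq Feq geq Ele Fle gle where
    cor: "extended_formulation ({1..n} \<times> {1..n}) (COR n) k p m Eeq Feq geq Ele Fle gle"
    using extended_formulation_COR_exists by blast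
  show "xc_CUT (n + 1) \<le> xc_COR n"
    unfolding CUT_eq_image_COR by (rule xc_image_le[OF fin finite_complete_edges cor])
  obtain k' p' Eeq' Feq' geq' Ele' Fle' gle' where
    cut: "extended_formulation (complete_edges (n + 1)) (CUT (n + 1)) k' p' m Eeq' Feq' geq' Ele' Fle' gle'"
    using extended_formulation_image[OF fin finite_complete_edges cor]
    unfolding CUT_eq_image_COR by blast
  show "xc_COR n \<le> xc_CUT (n + 1)"
    using xc_image_le[OF finite_complete_edges fin cut, of "cor_of_cut n"]
    unfolding COR_eq_image_CUT[symmetric] .
qed

subsection \<open>The exponential lower bound\<close>

lemma xc_COR_ge:
  assumes "n \<ge> 1"
  shows "real (xc_COR n) \<ge> 2 powr (log 2 (3/2) * real n)"
proof -
  obtain k p Eeq Feq geq Ele Fle gle where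
    "extended_formulation ({1..n} \<times> {1..n}) (COR n) k p (xc_COR n) Eeq Feq geq Ele Fle gle"
  proof -
    obtain k p m Eeq Feq geq Ele Fle gle where
      "extended_formulation ({1..n} \<times> {1..n}) (COR n) k p m Eeq Feq geq Ele Fle gle"
      using extended_formulation_COR_exists by blast
    from xc_attained[OF this] show ?thesis using that by blast
  qed
  then have "3 ^ n \<le> xc_COR n * 2 ^ n"
    by (rule extended_formulation_COR_size[OF assms])
  then have "real (3 ^ n) \<le> real (xc_COR n * 2 ^ n)"
    by (simp only: of_nat_le_iff)
  then have "(3/2) ^ n \<le> real (xc_COR n)"
    by (simp add: power_divide pos_divide_le_eq)
  also have "(3/2) ^ n = 2 powr (log 2 (3/2) * real n)"
    by (simp add: powr_powr[symmetric] powr_realpow)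
  finally show ?thesis .
qed

theorem theorem7:
  shows "(\<exists>C::real. C > 0 \<and> (\<forall>n::nat. n \<ge> 1 \<longrightarrow>
            xc_CUT (n + 1) = xc_COR n \<and> real (xc_COR n) \<ge> 2 powr (C * real n))) \<and>
         (\<exists>c::real. c > 0 \<and>
            (\<forall>\<^sub>F n in sequentially. real (xc_CUT n) \<ge> 2 powr (c * real n)))"
proof -
  define C :: real where "C = log 2 (3/2)"
  have "C > 0" by (simp add: C_def)
  have "2 powr (C / 2 * real n) \<le> real (xc_CUT n)" if "n \<ge> 2" for n
  proof -
    define k where "k = n - 1"
    have k: "n = k + 1" "k \<ge> 1" using that by (simp_all add: k_def)
    \<comment> \<open>Since \<open>k = n - 1\<close> is at least \<open>n / 2\<close> for
      \<open>n \<ge> 2\<close>, halving the constant absorbs the index shift.\<close>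
    have "C / 2 * real n \<le> C * real k"
      using \<open>C > 0\<close> k by (simp add: field_simps)
    then have "2 powr (C / 2 * real n) \<le> 2 powr (C * real k)" by simp
    also have "\<dots> \<le> real (xc_COR k)" unfolding C_def by (rule xc_COR_ge[OF k(2)])
    finally show ?thesis using xc_CUT_eq_xc_COR[of k] k(1) by simp
  qed
  then have "\<forall>\<^sub>F n in sequentially. real (xc_CUT n) \<ge> 2 powr (C / 2 * real n)"
    by (auto simp: eventually_sequentially)
  moreover have "C / 2 > 0" using \<open>C > 0\<close> by simp
  moreover have "\<forall>n::nat. n \<ge> 1 \<longrightarrow> xc_CUT (n + 1) = xc_COR n \<and> real (xc_COR n) \<ge> 2 powr (C * real n)"
    using xc_CUT_eq_xc_COR xc_COR_ge unfolding C_def by blast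
  ultimately show ?thesis using \<open>C > 0\<close> by blast
qed

end
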